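(* Let $R$ be a ring with involution, let $a\in R$ be Drazin invertible with a minimal weak Drazin inverse $a^{+}\in T_l(a)$, let $b\in R$ and $f=a+b$. If $f$ has a minimal weak Drazin inverse $f^{+}$, then the following statements are equivalent: (1) $a^{+}(a+f)f^{+}=a^{+}+f^{+}$; (2) $1+a^{+}b$ is invertible and $f^{+}=(1+a^{+}b)^{-1}a^{+}$.
   Context: Rings are associative with identity $1$. An element $a\in R$ is Drazin invertible if there are $x\in R$ and a positive integer $k$ with $xa^{k+1}=a^k$, $ax^2=x$, $xa=ax$. For a Drazin invertible $a$, $T_l(a)=\{x\in R:\ xa^{k+1}=a^k \text{ for some positive integer } k,\ ax^2=x\}$; its elements are called the minimal weak Drazin inverses of $a$. (If some $x\in R$ and positive integer $k$ satisfy $xa^{k+1}=a^k$ and $ax^2=x$, then $a$ is automatically Drazin invertible.) *)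

theory Defs
  imports "HOL-Algebra.Ring"
begin

locale ring_with_involution = ring R for R (structure) +
  fixes star :: "'a \<Rightarrow> 'a"
  assumes star_closed: "x \<in> carrier R \<Longrightarrow> star x \<in> carrier R"
    and star_star: "x \<in> carrier R \<Longrightarrow> star (star x) = x"
    and star_add: "\<lbrakk>x \<in> carrier R; y \<in> carrier R\<rbrakk> \<Longrightarrow> star (x \<oplus> y) = star x \<oplus> star y"
    and star_mult: "\<lbrakk>x \<in> carrier R; y \<in> carrier R\<rbrakk> \<Longrightarrow> star (x \<otimes> y) = star y \<otimes> star x"

definition drazin_invertible :: "('a, 'm) ring_scheme \<Rightarrow> 'a \<Rightarrow> bool" where
  "drazin_invertible R a \<longleftrightarrow>
     (\<exists>x \<in> carrier R. \<exists>k::nat. k > 0 \<and>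
        x \<otimes>\<^bsub>R\<^esub> (a [^]\<^bsub>R\<^esub> (k + 1)) = a [^]\<^bsub>R\<^esub> k \<and>
        a \<otimes>\<^bsub>R\<^esub> (x [^]\<^bsub>R\<^esub> (2::nat)) = x \<and>
        x \<otimes>\<^bsub>R\<^esub> a = a \<otimes>\<^bsub>R\<^esub> x)"

text \<open>
  The set \<open>T\<^sub>l(a)\<close>. Drazin invertibility of \<open>a\<close> is not part of the definition; the set is
  empty when \<open>a\<close> is not Drazin invertible.
\<close>

definition minimal_weak_drazin_inverses :: "('a, 'm) ring_scheme \<Rightarrow> 'a \<Rightarrow> 'a set" where
  "minimal_weak_drazin_inverses R a =
     {x \<in> carrier R.
        (\<exists>k::nat. k > 0 \<and> x \<otimes>\<^bsub>R\<^esub> (a [^]\<^bsub>R\<^esub> (k + 1)) = a [^]\<^bsub>R\<^esub> k) \<and>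
        a \<otimes>\<^bsub>R\<^esub> (x [^]\<^bsub>R\<^esub> (2::nat)) = x}"

end

theory Submission
  imports Defs
begin

text \<open>
  Write \<open>x\<close> and \<open>y\<close> for minimal weak Drazin inverses of \<open>a\<close> and \<open>f = a + b\<close>. Both
  statements of the theorem turn out to say that \<open>x a y = y\<close> and \<open>x f y = x\<close>.

  Multiplying \<open>x (a + f) y = x + y\<close> by the idempotent \<open>x a\<close> on the left leaves \<open>x f y = x\<close>, and
  then \<open>x a y = y\<close> is what remains. Subtracting the two identities gives \<open>(1 + x b) y = x\<close>, which
  makes \<open>1 - y b\<close> a right inverse of \<open>1 + x b\<close>. It is a left inverse as well if
  \<open>y a x = y\<close> and \<open>y f x = x\<close>, the same identities with \<open>x\<close> and \<open>y\<close> exchanged. These come from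
  the group structure behind minimal weak Drazin inverses: \<open>x\<close> is a unit of the corner ring at the
  idempotent \<open>a x\<close>, with inverse \<open>a a x\<close>, and likewise \<open>y\<close> at \<open>f y\<close>. The first two identities
  say that the left ideal of \<open>x\<close> lies in that of \<open>y\<close> and the right ideal of \<open>y\<close> in that of
  \<open>x\<close>, which is enough to force \<open>a x = f y\<close>; see \<open>idempotents_eq\<close>. The exchanged identities
  follow at once.

  Conversely \<open>(1 + x b) y = x\<close> puts \<open>y\<close> into the right ideal of \<open>x\<close>, on which \<open>x a\<close> acts as
  the identity; so \<open>x a y = y\<close>, and \<open>x f y = x\<close> follows.
\<close>

context ring
begin

lemma power_mult_power_Suc_absorb:
  assumes "a \<in> carrier R" "x \<in> carrier R" "a \<otimes> (x \<otimes> x) = x"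
  shows "a [^] n \<otimes> x [^] Suc n = x"
proof (induction n)
  case 0
  then show ?case using assms by simp
next
  case (Suc n)
  have "a [^] Suc n \<otimes> x [^] Suc (Suc n) = a [^] n \<otimes> ((a \<otimes> (x \<otimes> x)) \<otimes> x [^] n)"
    using assms(1,2) by (simp only: nat_pow_Suc[of a n] nat_pow_Suc2 m_assoc nat_pow_closed m_closed)
  also have "\<dots> = a [^] n \<otimes> x [^] Suc n"
    using assms(2) by (simp only: assms(3) nat_pow_Suc2)
  finally show ?case using Suc by simp
qed

text \<open>
  Since \<open>x = a\<^sup>k x\<^sup>k\<^sup>+\<^sup>1\<close> for every \<open>k\<close>, both \<open>x\<close> and \<open>a x\<close> lie in the right ideal
  of \<open>a\<^sup>k\<close>, on which left multiplication by \<open>x a\<close> is the identity. The three identities together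
  say that \<open>x\<close> is a unit with inverse \<open>a a x\<close> in the corner ring of the idempotent \<open>a x\<close>.
\<close>

lemma minimal_weak_drazin_inverse_identities:
  assumes a: "a \<in> carrier R" and "x \<in> minimal_weak_drazin_inverses R a"
  shows "x \<in> carrier R" "a \<otimes> (x \<otimes> x) = x" "x \<otimes> (a \<otimes> x) = x" "x \<otimes> (a \<otimes> (a \<otimes> x)) = a \<otimes> x"
proof -
  from assms(2) obtain k :: nat where x: "x \<in> carrier R"
    and k: "x \<otimes> a [^] Suc k = a [^] k" and "a \<otimes> x [^] (2::nat) = x"
    unfolding minimal_weak_drazin_inverses_def by auto
  then have axx: "a \<otimes> (x \<otimes> x) = x" by (simp add: numeral_2_eq_2)
  have fix_ideal: "x \<otimes> (a \<otimes> (a [^] k \<otimes> w)) = a [^] k \<otimes> w" if "w \<in> carrier R" for w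
  proof -
    have "x \<otimes> (a \<otimes> (a [^] k \<otimes> w)) = (x \<otimes> a [^] Suc k) \<otimes> w"
      using a x that by (simp only: nat_pow_Suc2 m_assoc nat_pow_closed m_closed)
    then show ?thesis by (simp only: k)
  qed
  have x_eq: "a [^] k \<otimes> x [^] Suc k = x"
    using power_mult_power_Suc_absorb[OF a x axx] .
  have "a \<otimes> x = a [^] k \<otimes> (a \<otimes> x [^] Suc k)"
  proof -
    have "a \<otimes> (a [^] k \<otimes> x [^] Suc k) = a [^] Suc k \<otimes> x [^] Suc k"
      using a x by (simp only: nat_pow_Suc2 m_assoc nat_pow_closed m_closed)
    then show ?thesis using a x by (simp only: x_eq) (simp add: m_assoc)
  qed
  then show "x \<otimes> (a \<otimes> (a \<otimes> x)) = a \<otimes> x"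
    using fix_ideal[of "a \<otimes> x [^] Suc k"] a x by simp
  show "x \<otimes> (a \<otimes> x) = x"
    using fix_ideal[of "x [^] Suc k"] x_eq x by simp
  show "x \<in> carrier R" "a \<otimes> (x \<otimes> x) = x" by (fact x, fact axx)
qed

text \<open>
  With \<open>u = a x\<close> and \<open>v = f y\<close>, the inclusion of left ideals \<open>Rx \<subseteq> Ry\<close> reads \<open>u v = u\<close>,
  and the inclusion of right ideals \<open>yR \<subseteq> xR\<close> reads \<open>u v = v\<close>.
\<close>

lemma idempotents_eq:
  assumes a: "a \<in> carrier R" and f: "f \<in> carrier R"
    and xT: "x \<in> minimal_weak_drazin_inverses R a"
    and yT: "y \<in> minimal_weak_drazin_inverses R f"
    and xay: "x \<otimes> (a \<otimes> y) = y" and xfy: "x \<otimes> (f \<otimes> y) = x"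
  shows "a \<otimes> x = f \<otimes> y"
proof -
  note xs = minimal_weak_drazin_inverse_identities[OF a xT]
  note ys = minimal_weak_drazin_inverse_identities[OF f yT]
  note cl = a f xs(1) ys(1)
  have "a \<otimes> (x \<otimes> y) = (a \<otimes> (x \<otimes> x)) \<otimes> (a \<otimes> y)"
    using cl by (simp add: m_assoc xay)
  then have axy: "a \<otimes> (x \<otimes> y) = y" by (simp only: xs(2) xay)
  have "a \<otimes> x = a \<otimes> (x \<otimes> (f \<otimes> y))" by (simp only: xfy)
  also have "\<dots> = a \<otimes> (x \<otimes> (y \<otimes> (f \<otimes> (f \<otimes> y))))" by (simp only: ys(4))
  also have "\<dots> = (a \<otimes> (x \<otimes> y)) \<otimes> (f \<otimes> (f \<otimes> y))" using cl by (simp add: m_assoc)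
  also have "\<dots> = f \<otimes> y" by (simp only: axy ys(4))
  finally show ?thesis .
qed

lemma inverse_identities_exchanged:
  assumes a: "a \<in> carrier R" and f: "f \<in> carrier R"
    and xT: "x \<in> minimal_weak_drazin_inverses R a"
    and yT: "y \<in> minimal_weak_drazin_inverses R f"
    and xay: "x \<otimes> (a \<otimes> y) = y" and xfy: "x \<otimes> (f \<otimes> y) = x"
  shows "y \<otimes> (a \<otimes> x) = y" "y \<otimes> (f \<otimes> x) = x"
proof -
  note xs = minimal_weak_drazin_inverse_identities[OF a xT]
  note ys = minimal_weak_drazin_inverse_identities[OF f yT]
  note cl = a f xs(1) ys(1)
  note eq = idempotents_eq[OF assms]
  show "y \<otimes> (a \<otimes> x) = y" by (simp only: eq ys(3))
  have x_eq: "x = (f \<otimes> y) \<otimes> x"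
    using cl xs(2) by (simp add: eq[symmetric] m_assoc)
  have "y \<otimes> (f \<otimes> ((f \<otimes> y) \<otimes> x)) = (y \<otimes> (f \<otimes> (f \<otimes> y))) \<otimes> x"
    using cl by (simp add: m_assoc)
  then show "y \<otimes> (f \<otimes> x) = x" by (simp only: ys(4) x_eq[symmetric])
qed

text \<open>
  The identity \<open>(1 + x b) y = x\<close> alone gives \<open>(1 + x b) (1 - y b) = 1\<close>; its mirror image
  \<open>y (1 + b x) = x\<close> gives the product in the other order.
\<close>

lemma one_plus_mult_inverse:
  assumes cl: "x \<in> carrier R" "y \<in> carrier R" "b \<in> carrier R"
    and right: "y \<oplus> x \<otimes> (b \<otimes> y) = x" and left: "y \<oplus> y \<otimes> (b \<otimes> x) = x"
  shows "\<one> \<oplus> x \<otimes> b \<in> Units R"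
proof -
  have 1: "(\<one> \<oplus> x \<otimes> b) \<otimes> (\<one> \<ominus> y \<otimes> b) = \<one>"
  proof -
    have "(\<one> \<oplus> x \<otimes> b) \<otimes> (\<one> \<ominus> y \<otimes> b) = \<one> \<oplus> (x \<otimes> b \<ominus> (y \<oplus> x \<otimes> (b \<otimes> y)) \<otimes> b)"
      using cl by (simp add: a_minus_def l_distr r_distr l_minus r_minus minus_add m_assoc a_ac)
    then show ?thesis using cl by (simp add: right r_neg a_minus_def)
  qed
  have 2: "(\<one> \<ominus> y \<otimes> b) \<otimes> (\<one> \<oplus> x \<otimes> b) = \<one>"
  proof -
    have "(\<one> \<ominus> y \<otimes> b) \<otimes> (\<one> \<oplus> x \<otimes> b) = \<one> \<oplus> (x \<otimes> b \<ominus> (y \<oplus> y \<otimes> (b \<otimes> x)) \<otimes> b)"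
      using cl by (simp add: a_minus_def l_distr r_distr l_minus r_minus minus_add m_assoc a_ac)
    then show ?thesis using cl by (simp add: left r_neg a_minus_def)
  qed
  show ?thesis
    unfolding Units_def using 1 2 cl by auto
qed

lemma absorption_iff_inverse_formula:
  assumes a: "a \<in> carrier R" and b: "b \<in> carrier R" and f: "f = a \<oplus> b"
    and xT: "x \<in> minimal_weak_drazin_inverses R a"
    and yT: "y \<in> minimal_weak_drazin_inverses R f"
  shows "x \<otimes> (a \<oplus> f) \<otimes> y = x \<oplus> y \<longleftrightarrow>
         \<one> \<oplus> x \<otimes> b \<in> Units R \<and> y = inv (\<one> \<oplus> x \<otimes> b) \<otimes> x"
proof -
  have fc: "f \<in> carrier R" using a b f by simp
  note xs = minimal_weak_drazin_inverse_identities[OF a xT]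
  note yc = minimal_weak_drazin_inverse_identities(1)[OF fc yT]
  note cl = a b fc xs(1) yc
  have expand: "x \<otimes> (a \<oplus> f) \<otimes> y = x \<otimes> (a \<otimes> y) \<oplus> x \<otimes> (f \<otimes> y)"
    using cl by algebra
  have split: "p \<otimes> (f \<otimes> q) = p \<otimes> (a \<otimes> q) \<oplus> p \<otimes> (b \<otimes> q)"
    if "p \<in> carrier R" "q \<in> carrier R" for p q
    unfolding f using that a b by algebra
  have xa_absorb: "x \<otimes> (a \<otimes> (x \<otimes> z)) = x \<otimes> z" if "z \<in> carrier R" for z
  proof -
    have "x \<otimes> (a \<otimes> (x \<otimes> z)) = (x \<otimes> (a \<otimes> x)) \<otimes> z" using cl that by (simp add: m_assoc)
    then show ?thesis by (simp only: xs(3))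
  qed
  have unit_eq: "(\<one> \<oplus> x \<otimes> b) \<otimes> y = y \<oplus> x \<otimes> (b \<otimes> y)" using cl by algebra
  show ?thesis
  proof
    assume "x \<otimes> (a \<oplus> f) \<otimes> y = x \<oplus> y"
    then have sum: "x \<otimes> (a \<otimes> y) \<oplus> x \<otimes> (f \<otimes> y) = x \<oplus> y" by (simp only: expand)
    \<comment> \<open>Left multiplication by \<open>x a\<close> fixes \<open>x a y + x f y\<close>, while it sends \<open>x + y\<close> to \<open>x + x a y\<close>.\<close>
    have "x \<otimes> (a \<otimes> y) \<oplus> x \<otimes> (f \<otimes> y) = x \<otimes> (a \<otimes> (x \<otimes> (a \<otimes> y) \<oplus> x \<otimes> (f \<otimes> y)))"
      using cl xa_absorb by (simp add: r_distr)
    also have "\<dots> = x \<otimes> (a \<otimes> y) \<oplus> x"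
      using cl xs(3) by (simp add: sum r_distr a_comm)
    finally have xfy: "x \<otimes> (f \<otimes> y) = x" using cl by simp
    with sum have xay: "x \<otimes> (a \<otimes> y) = y" using cl by (simp add: a_comm)
    note exch = inverse_identities_exchanged[OF a fc xT yT xay xfy]
    have right: "y \<oplus> x \<otimes> (b \<otimes> y) = x" using split[of x y] cl xay xfy by simp
    have left: "y \<oplus> y \<otimes> (b \<otimes> x) = x" using split[of y x] cl exch by simp
    have unit: "\<one> \<oplus> x \<otimes> b \<in> Units R"
      using one_plus_mult_inverse[OF _ _ _ right left] cl by simp
    have "inv (\<one> \<oplus> x \<otimes> b) \<otimes> x = inv (\<one> \<oplus> x \<otimes> b) \<otimes> ((\<one> \<oplus> x \<otimes> b) \<otimes> y)"
      by (simp only: unit_eq right)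
    also have "\<dots> = y" using unit cl by (simp add: m_assoc[symmetric])
    finally show "\<one> \<oplus> x \<otimes> b \<in> Units R \<and> y = inv (\<one> \<oplus> x \<otimes> b) \<otimes> x" using unit by simp
  next
    assume "\<one> \<oplus> x \<otimes> b \<in> Units R \<and> y = inv (\<one> \<oplus> x \<otimes> b) \<otimes> x"
    then have unit: "\<one> \<oplus> x \<otimes> b \<in> Units R" and y: "y = inv (\<one> \<oplus> x \<otimes> b) \<otimes> x" by auto
    have "(\<one> \<oplus> x \<otimes> b) \<otimes> (inv (\<one> \<oplus> x \<otimes> b) \<otimes> x) = x"
      using unit cl by (simp add: m_assoc[symmetric])
    then have right: "y \<oplus> x \<otimes> (b \<otimes> y) = x"
      by (simp only: y[symmetric] unit_eq)
    have "y = (y \<oplus> x \<otimes> (b \<otimes> y)) \<ominus> x \<otimes> (b \<otimes> y)" using cl by algebra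
    also have "\<dots> = x \<otimes> (\<one> \<ominus> b \<otimes> y)" unfolding right using cl by (simp add: a_minus_def r_distr r_minus)
    finally have "y = x \<otimes> (\<one> \<ominus> b \<otimes> y)" .
    then have xay: "x \<otimes> (a \<otimes> y) = y"
      using xa_absorb[of "\<one> \<ominus> b \<otimes> y"] cl by simp
    then have "x \<otimes> (f \<otimes> y) = x" using split[of x y] right cl by simp
    with xay show "x \<otimes> (a \<oplus> f) \<otimes> y = x \<oplus> y" using cl by (simp add: expand a_comm)
  qed
qed

end

theorem theorem3p3:
  fixes R (structure)
    and star :: "'a \<Rightarrow> 'a"
    and a b f a' f' :: 'a
  assumes "ring_with_involution R star"
    and "a \<in> carrier R"
    and "drazin_invertible R a"
    and "a' \<in> minimal_weak_drazin_inverses R a"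
    and "b \<in> carrier R"
    and "f = a \<oplus> b"
    and "f' \<in> minimal_weak_drazin_inverses R f"
  shows "a' \<otimes> (a \<oplus> f) \<otimes> f' = a' \<oplus> f' \<longleftrightarrow>
         \<one> \<oplus> a' \<otimes> b \<in> Units R \<and> f' = inv (\<one> \<oplus> a' \<otimes> b) \<otimes> a'"
proof -
  interpret ring_with_involution R star by fact
  show ?thesis
    using assms by (intro absorption_iff_inverse_formula)
qed

end
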